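(* Let $\mathcal{X}=\{1,\dots,m\}$, let $q$ be a positive measure on $\mathcal{X}$ with full support, let $A\in\mathbb{R}^{d\times m}$ be a matrix whose row span contains $(1,\dots,1)$, and let $C$ be a circuit basis of $A$. Then $\overline{\mathcal{E}_{q,A}}$ equals the set of all probability distributions $p$ on $\mathcal{X}$ that satisfy $$p^{c^{+}} q^{c^{-}} = p^{c^{-}} q^{c^{+}}\qquad\text{for all } c\in C .$$
   Context: $\mathcal{P}(\mathcal{X})$ is the open simplex of probability measures with full support on $\mathcal{X}$, viewed as a subset of $\mathbb{R}^{\mathcal{X}}$; closures are taken in the standard topology of $\mathbb{R}^{\mathcal{X}}$. The columns of $A$ are denoted $a_x\in\mathbb{R}^d$, $x\in\mathcal{X}$. The exponential family associated with $q$ and $A$ is $$\mathcal{E}_{q,A}=\Big\{p_\theta\in\mathcal{P}(\mathcal{X}) : p_\theta(x)=\frac{q(x)}{Z_\theta}\exp(\theta^{T}a_x),\ \theta\in\mathbb{R}^d\Big\},\qquad Z_\theta=\sum_{x\in\mathcal{X}}q(x)\exp(\theta^{T}a_x).$$ For $n\in\mathbb{R}^{\mathcal{X}}$ put $n^{+}(x)=\max(n(x),0)$ and $n^{-}(x)=\max(-n(x),0)$. For non-negative $p,u\in\mathbb{R}^{\mathcal{X}}$ put $p^{u}=\prod_{x\in\mathcal{X}}p(x)^{u(x)}$, with the convention $0^0=1$. For $n\in\mathbb{R}^{\mathcal X}$, $\operatorname{supp}(n)=\{x: n(x)\neq 0\}$. A circuit vector of $A$ is a nonzero vector $n\in\ker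 A$ with inclusion-minimal support, i.e. if $n'\in\ker A$ satisfies $\operatorname{supp}(n')\subseteq\operatorname{supp}(n)$, then $n'=\lambda n$ for some $\lambda\in\mathbb{R}$. A circuit is the support set of a circuit vector. A circuit basis of $A$ is a subset of $\ker A$ containing precisely one circuit vector for every circuit (and consisting only of these circuit vectors). *)

theory Defs
  imports "HOL-Analysis.Analysis"
begin

(* The sample space X is a finite type 'm, functions on X are vectors in real ^ 'm,
   and a (d x m)-matrix is an element of real ^ 'm ^ 'd. *)

definition prob_distributions :: "(real ^ 'm::finite) set" where
  "prob_distributions = {p. (\<forall>x. 0 \<le> p $ x) \<and> (\<Sum>x\<in>UNIV. p $ x) = 1}"

definition open_simplex :: "(real ^ 'm::finite) set" where
  "open_simplex = {p. (\<forall>x. 0 < p $ x) \<and> (\<Sum>x\<in>UNIV. p $ x) = 1}"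

definition partition_fun ::
    "real ^ 'm::finite \<Rightarrow> real ^ 'm ^ 'd::finite \<Rightarrow> real ^ 'd \<Rightarrow> real" where
  "partition_fun q A \<theta> = (\<Sum>x\<in>UNIV. q $ x * exp (\<theta> \<bullet> column x A))"

definition exp_family :: "real ^ 'm::finite \<Rightarrow> real ^ 'm ^ 'd::finite \<Rightarrow> (real ^ 'm) set" where
  "exp_family q A = {p \<in> open_simplex.
     \<exists>\<theta>. \<forall>x. p $ x = q $ x / partition_fun q A \<theta> * exp (\<theta> \<bullet> column x A)}"

definition pos_part :: "real ^ 'm::finite \<Rightarrow> real ^ 'm" where
  "pos_part n = (\<chi> x. max (n $ x) 0)"

definition neg_part :: "real ^ 'm::finite \<Rightarrow> real ^ 'm" where
  "neg_part n = (\<chi> x. max (- n $ x) 0)"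

(* Library powr satisfies 0 powr 0 = 0, whereas the convention here is 0^0 = 1. *)
definition vec_power :: "real ^ 'm::finite \<Rightarrow> real ^ 'm \<Rightarrow> real" where
  "vec_power p u = (\<Prod>x\<in>UNIV. if u $ x = 0 then 1 else p $ x powr u $ x)"

definition vec_supp :: "real ^ 'm::finite \<Rightarrow> 'm set" where
  "vec_supp n = {x. n $ x \<noteq> 0}"

definition circuit_vector :: "real ^ 'm::finite ^ 'd::finite \<Rightarrow> real ^ 'm \<Rightarrow> bool" where
  "circuit_vector A n \<longleftrightarrow> n \<noteq> 0 \<and> A *v n = 0 \<and>
     (\<forall>n'. A *v n' = 0 \<and> vec_supp n' \<subseteq> vec_supp n \<longrightarrow> (\<exists>r. n' = r *\<^sub>R n))"

definition circuit :: "real ^ 'm::finite ^ 'd::finite \<Rightarrow> 'm set \<Rightarrow> bool" where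
  "circuit A S \<longleftrightarrow> (\<exists>n. circuit_vector A n \<and> S = vec_supp n)"

definition circuit_basis :: "real ^ 'm::finite ^ 'd::finite \<Rightarrow> (real ^ 'm) set \<Rightarrow> bool" where
  "circuit_basis A C \<longleftrightarrow> (\<forall>c\<in>C. circuit_vector A c) \<and>
     (\<forall>S. circuit A S \<longrightarrow> (\<exists>!c. c \<in> C \<and> vec_supp c = S))"

end

theory Submission imports Defs begin

text \<open>
  Taking logarithms turns the binomial equation of \<open>c\<close> into the linear equation
  \<open>(\<Sum>x. c x * ln (p x / q x)) = 0\<close> wherever \<open>p\<close> is positive on the support of \<open>c\<close>.  For
  \<open>p\<close> in the family, \<open>ln (p / q)\<close> is a combination of the rows of \<open>A\<close> and of the constant
  vector, which is itself in their span; hence it is orthogonal to \<open>ker A\<close>.  The equations thus hold on the family, and by continuity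
  on its closure.

  Conversely let \<open>p\<close> solve the equations and let \<open>Y\<close> be its support.  Two linear facts are
  extracted from them.

  \<^item> The circuit vectors supported in \<open>Y\<close> are orthogonal to \<open>ln (p / q)\<close>.  Any vector of
    \<open>ker A\<close> of minimal support among those supported in \<open>Y\<close> and not orthogonal to
    \<open>ln (p / q)\<close> would be a circuit vector
    (\<open>kernel_orthogonal_if_circuits_orthogonal\<close>); so there is none, and by duality
    \<open>ln (p / q)\<close> agrees on \<open>Y\<close> with \<open>x \<mapsto> \<theta> \<bullet> a\<^sub>x\<close> for some \<open>\<theta>\<close>.
  \<^item> The two sides of an equation vanish simultaneously, so no circuit vector is nonnegative but
    not identically zero off \<open>Y\<close>.  Again a minimal support argument extends this to all of
    \<open>ker A\<close> (\<open>kernel_face_condition_if_circuits\<close>), and a theorem of the alternative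
    (\<open>exposing_functional\<close>) gives \<open>\<eta>\<close> with \<open>\<eta> \<bullet> a\<^sub>x = 0\<close> on \<open>Y\<close> and
    \<open>\<eta> \<bullet> a\<^sub>x < 0\<close> off \<open>Y\<close>: the columns indexed by \<open>Y\<close> are those on a face of
    the convex hull of all columns.

  The members of the family with parameters \<open>\<theta> + k \<eta>\<close> then converge to \<open>p\<close> as
  \<open>k\<close> tends to infinity.
\<close>

section \<open>Circuit vectors and minimal supports\<close>

text \<open>The elimination step behind every minimal support argument: subtract the multiple of
  \<open>n'\<close> that cancels one coordinate of \<open>n\<close>.\<close>

lemma kernel_elimination:
  fixes A :: "real ^ 'm::finite ^ 'd::finite"
  assumes "A *v n = 0" "A *v n' = 0" "n' \<noteq> 0" "vec_supp n' \<subseteq> vec_supp n"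
  obtains t where "A *v (n - t *\<^sub>R n') = 0" "vec_supp (n - t *\<^sub>R n') \<subset> vec_supp n"
proof -
  obtain x where x: "n' $ x \<noteq> 0"
    using assms(3) by (auto simp: vec_eq_iff)
  let ?t = "n $ x / n' $ x"
  have "A *v (n - ?t *\<^sub>R n') = 0"
    using assms by (simp add: matrix_vector_mult_diff_distrib matrix_vector_mult_scaleR)
  moreover have "x \<in> vec_supp n" "x \<notin> vec_supp (n - ?t *\<^sub>R n')"
    using x assms(4) by (auto simp: vec_supp_def)
  moreover have "vec_supp (n - ?t *\<^sub>R n') \<subseteq> vec_supp n"
    using assms(4) by (auto simp: vec_supp_def)
  ultimately show thesis
    using that by blast
qed

lemma minimal_support_exists:
  fixes n :: "real ^ 'm::finite"
  assumes "P n"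
  obtains n0 where "P n0" "\<And>n'. P n' \<Longrightarrow> \<not> vec_supp n' \<subset> vec_supp n0"
proof -
  obtain n0 where "P n0" "\<And>n'. P n' \<Longrightarrow> card (vec_supp n0) \<le> card (vec_supp n')"
    using ex_has_least_nat[of P n "\<lambda>n. card (vec_supp n)"] assms by blast
  then show thesis
    using that by (metis finite linorder_not_less psubset_card_mono)
qed

text \<open>A vector of minimal support among the kernel vectors supported in \<open>Y\<close> and not
  orthogonal to \<open>l\<close> is a circuit vector: elimination with a kernel vector orthogonal to
  \<open>l\<close> keeps the inner product with \<open>l\<close>, so no such vector lives on its support, and
  every other kernel vector on its support becomes orthogonal to \<open>l\<close> after subtracting a
  multiple of it.\<close>

lemma kernel_orthogonal_if_circuits_orthogonal:
  fixes A :: "real ^ 'm::finite ^ 'd::finite"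
  assumes circ: "\<And>c. circuit_vector A c \<Longrightarrow> vec_supp c \<subseteq> Y \<Longrightarrow> c \<bullet> l = 0"
    and "A *v n = 0" "vec_supp n \<subseteq> Y"
  shows "n \<bullet> l = 0"
proof (rule ccontr)
  assume "n \<bullet> l \<noteq> 0"
  with assms(2,3) have "A *v n = 0 \<and> vec_supp n \<subseteq> Y \<and> n \<bullet> l \<noteq> 0"
    by simp
  then obtain n0 where n0: "A *v n0 = 0" "vec_supp n0 \<subseteq> Y" "n0 \<bullet> l \<noteq> 0"
    and minimal: "\<And>n'. A *v n' = 0 \<and> vec_supp n' \<subseteq> Y \<and> n' \<bullet> l \<noteq> 0 \<Longrightarrow>
      \<not> vec_supp n' \<subset> vec_supp n0"
    by (rule minimal_support_exists) blast
  have orth_zero: "m = 0" if m: "A *v m = 0" "vec_supp m \<subseteq> vec_supp n0" "m \<bullet> l = 0" for m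
  proof (rule ccontr)
    assume "m \<noteq> 0"
    then obtain t where t: "A *v (n0 - t *\<^sub>R m) = 0"
      "vec_supp (n0 - t *\<^sub>R m) \<subset> vec_supp n0"
      using kernel_elimination[OF n0(1) m(1) _ m(2)] by blast
    moreover have "(n0 - t *\<^sub>R m) \<bullet> l \<noteq> 0"
      using m(3) n0(3) by (simp add: inner_diff_left)
    ultimately show False
      using minimal n0(2) by blast
  qed
  have "\<exists>r. n' = r *\<^sub>R n0" if n': "A *v n' = 0" "vec_supp n' \<subseteq> vec_supp n0" for n'
  proof -
    let ?m = "n' - ((n' \<bullet> l) / (n0 \<bullet> l)) *\<^sub>R n0"
    have "A *v ?m = 0"
      using n' n0 by (simp add: matrix_vector_mult_diff_distrib matrix_vector_mult_scaleR)
    moreover have "vec_supp ?m \<subseteq> vec_supp n0"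
      using n'(2) by (auto simp: vec_supp_def)
    moreover have "?m \<bullet> l = 0"
      using n0(3) by (simp add: inner_diff_left)
    ultimately have "?m = 0"
      by (rule orth_zero)
    then show ?thesis
      by (intro exI[of _ "(n' \<bullet> l) / (n0 \<bullet> l)"]) simp
  qed
  moreover have "n0 \<noteq> 0"
    using n0(3) by auto
  ultimately have "circuit_vector A n0"
    using n0(1) by (auto simp: circuit_vector_def)
  then show False
    using circ n0 by blast
qed

text \<open>A kernel vector \<open>n0\<close> of minimal support among those nonnegative but not identically zero
  off \<open>Y\<close> is a circuit vector.  Kernel vectors on its support that vanish off \<open>Y\<close> are
  excluded by elimination, which does not change \<open>n0\<close> off \<open>Y\<close>.  From any other one, up to
  sign, the largest multiple is subtracted from \<open>n0\<close> that keeps the difference nonnegative off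
  \<open>Y\<close>; it cancels a coordinate, so by minimality the difference vanishes off \<open>Y\<close>, hence
  everywhere.\<close>

lemma kernel_face_condition_if_circuits:
  fixes A :: "real ^ 'm::finite ^ 'd::finite"
  assumes circ: "\<And>c. circuit_vector A c \<Longrightarrow> \<forall>x. x \<notin> Y \<longrightarrow> 0 \<le> c $ x \<Longrightarrow> \<forall>x. x \<notin> Y \<longrightarrow> c $ x = 0"
    and "A *v n = 0" "\<forall>x. x \<notin> Y \<longrightarrow> 0 \<le> n $ x"
  shows "\<forall>x. x \<notin> Y \<longrightarrow> n $ x = 0"
proof (rule ccontr)
  define P where "P n \<longleftrightarrow> A *v n = 0 \<and> (\<forall>x. x \<notin> Y \<longrightarrow> 0 \<le> n $ x) \<and> \<not> (\<forall>x. x \<notin> Y \<longrightarrow> n $ x = 0)" for n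
  assume "\<not> ?thesis"
  with assms(2,3) have "P n"
    by (simp add: P_def)
  then obtain n0 where "P n0"
    and minimal: "\<And>n'. P n' \<Longrightarrow> \<not> vec_supp n' \<subset> vec_supp n0"
    by (rule minimal_support_exists) blast
  then have n0: "A *v n0 = 0" "\<And>x. x \<notin> Y \<Longrightarrow> 0 \<le> n0 $ x" "\<not> (\<forall>x. x \<notin> Y \<longrightarrow> n0 $ x = 0)"
    by (auto simp: P_def)
  have off_zero: "m = 0"
    if m: "A *v m = 0" "vec_supp m \<subseteq> vec_supp n0" "\<forall>x. x \<notin> Y \<longrightarrow> m $ x = 0" for m
  proof (rule ccontr)
    assume "m \<noteq> 0"
    then obtain t where t: "A *v (n0 - t *\<^sub>R m) = 0"
      "vec_supp (n0 - t *\<^sub>R m) \<subset> vec_supp n0"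
      using kernel_elimination[OF n0(1) m(1) _ m(2)] by blast
    moreover have "P (n0 - t *\<^sub>R m)"
      using m(3) n0 t(1) by (auto simp: P_def)
    ultimately show False
      using minimal by blast
  qed
  have positive_case: "\<exists>r. n' = r *\<^sub>R n0"
    if n': "A *v n' = 0" "vec_supp n' \<subseteq> vec_supp n0" and x0: "x0 \<notin> Y" "0 < n' $ x0" for n' x0
  proof -
    define T where "T = {x. x \<notin> Y \<and> 0 < n' $ x}"
    define t where "t = Min ((\<lambda>x. n0 $ x / n' $ x) ` T)"
    have T: "finite T" "T \<noteq> {}"
      using x0 by (auto simp: T_def)
    then have "t \<in> (\<lambda>x. n0 $ x / n' $ x) ` T"
      unfolding t_def by (intro Min_in) auto
    then obtain x1 where x1: "x1 \<in> T" "t = n0 $ x1 / n' $ x1"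
      by auto
    have t_le: "t \<le> n0 $ x / n' $ x" if "x \<in> T" for x
      unfolding t_def using T that by (intro Min_le) auto
    have x1_supp: "x1 \<in> vec_supp n0"
      using x1(1) n'(2) by (force simp: T_def vec_supp_def)
    then have "0 < n0 $ x1"
      using x1(1) n0(2)[of x1] by (auto simp: T_def vec_supp_def)
    then have "0 < t"
      using x1 by (simp add: T_def)
    let ?m = "n0 - t *\<^sub>R n'"
    have m_ker: "A *v ?m = 0"
      using n' n0 by (simp add: matrix_vector_mult_diff_distrib matrix_vector_mult_scaleR)
    have m_nonneg: "0 \<le> ?m $ x" if "x \<notin> Y" for x
    proof (cases "x \<in> T")
      case True
      then show ?thesis
        using t_le[of x] by (simp add: T_def field_simps)
    next
      case False
      then have "t * n' $ x \<le> 0"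
        using that \<open>0 < t\<close> by (simp add: T_def mult_nonneg_nonpos)
      then show ?thesis
        using n0(2)[OF that] by simp
    qed
    have "x1 \<notin> vec_supp ?m"
      using x1 by (simp add: T_def vec_supp_def)
    moreover have m_supp: "vec_supp ?m \<subseteq> vec_supp n0"
      using n'(2) by (auto simp: vec_supp_def)
    ultimately have "vec_supp ?m \<subset> vec_supp n0"
      using x1_supp by blast
    then have "\<not> P ?m"
      using minimal by blast
    then have "\<forall>x. x \<notin> Y \<longrightarrow> ?m $ x = 0"
      using m_ker m_nonneg unfolding P_def by blast
    with m_ker m_supp have "?m = 0"
      by (rule off_zero)
    then have "n' = (1 / t) *\<^sub>R n0"
      using \<open>0 < t\<close> by simp
    then show ?thesis ..
  qed
  have "\<exists>r. n' = r *\<^sub>R n0" if n': "A *v n' = 0" "vec_supp n' \<subseteq> vec_supp n0" for n'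
  proof -
    consider "\<forall>x. x \<notin> Y \<longrightarrow> n' $ x = 0" | x where "x \<notin> Y" "0 < n' $ x" | x where "x \<notin> Y" "n' $ x < 0"
      by (metis linorder_neqE)
    then show ?thesis
    proof cases
      case 1
      then have "n' = 0 *\<^sub>R n0"
        using off_zero n' by simp
      then show ?thesis ..
    next
      case 2
      then show ?thesis
        using positive_case n' by blast
    next
      case 3
      have "A *v (- n') = 0"
        using n'(1) matrix_vector_mult_scaleR[of A "-1" n'] by simp
      moreover have "vec_supp (- n') \<subseteq> vec_supp n0"
        using n'(2) by (auto simp: vec_supp_def)
      ultimately obtain r where "- n' = r *\<^sub>R n0"
        using positive_case[of "- n'" x] 3 by auto
      then have "n' = (- r) *\<^sub>R n0"
        by (metis minus_minus scaleR_minus_left)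
      then show ?thesis ..
    qed
  qed
  moreover have "n0 \<noteq> 0"
    using n0(3) by auto
  ultimately have "circuit_vector A n0"
    using n0(1) by (auto simp: circuit_vector_def)
  then show False
    using circ n0 by blast
qed

lemma circuit_vector_multiple_of_basis:
  fixes A :: "real ^ 'm::finite ^ 'd::finite"
  assumes "circuit_basis A C" "circuit_vector A n"
  obtains c r where "c \<in> C" "r \<noteq> 0" "n = r *\<^sub>R c"
proof -
  have "circuit A (vec_supp n)"
    using assms(2) by (auto simp: circuit_def)
  then obtain c where c: "c \<in> C" "vec_supp c = vec_supp n"
    using assms(1) unfolding circuit_basis_def by blast
  then have "circuit_vector A c"
    using assms(1) by (simp add: circuit_basis_def)
  then obtain r where "n = r *\<^sub>R c"
    using assms(2) c(2) unfolding circuit_vector_def by (metis order_refl)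
  moreover have "r \<noteq> 0"
    using calculation assms(2) by (auto simp: circuit_vector_def)
  ultimately show thesis
    using that c(1) by blast
qed

section \<open>Duality between the kernel and the row space\<close>

lemma inner_column:
  fixes A :: "real ^ 'm::finite ^ 'd::finite"
  shows "\<theta> \<bullet> column x A = (\<theta> v* A) $ x"
  by (simp add: column_def inner_vec_def vector_matrix_mult_def mult.commute)

lemma sum_kernel_inner_column:
  fixes A :: "real ^ 'm::finite ^ 'd::finite"
  assumes "A *v n = 0"
  shows "(\<Sum>x\<in>UNIV. n $ x * (\<theta> \<bullet> column x A)) = 0"
proof -
  have "(\<Sum>x\<in>UNIV. n $ x * (\<theta> \<bullet> column x A)) = (\<theta> v* A) \<bullet> n"
    unfolding inner_column by (simp add: inner_vec_def mult.commute)
  then show ?thesis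
    using assms by (simp add: dot_lmul_matrix)
qed

lemma sum_kernel_zero:
  fixes A :: "real ^ 'm::finite ^ 'd::finite"
  assumes "(\<chi> x. 1) \<in> span (rows A)" "A *v n = 0"
  shows "(\<Sum>x\<in>UNIV. n $ x) = 0"
proof -
  have "A $ i \<bullet> n = 0" for i
    using assms(2) by (metis matrix_vector_mul_component zero_index)
  then have "orthogonal n y" if "y \<in> rows A" for y
    using that by (auto simp: rows_def row_def orthogonal_def inner_commute)
  then have "orthogonal n (\<chi> x. 1)"
    by (rule orthogonal_to_span[OF assms(1)])
  then show ?thesis
    by (simp add: orthogonal_def inner_vec_def)
qed

text \<open>This is the equality of the row space with the orthogonal complement of the kernel, applied
  to the matrix obtained from \<open>A\<close> by erasing the columns outside \<open>Y\<close>.\<close>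

lemma row_space_on_if_orthogonal_kernel:
  fixes A :: "real ^ 'm::finite ^ 'd::finite"
  assumes "\<And>n. A *v n = 0 \<Longrightarrow> vec_supp n \<subseteq> Y \<Longrightarrow> n \<bullet> l = 0"
  obtains \<theta> where "\<And>x. x \<in> Y \<Longrightarrow> l $ x = \<theta> \<bullet> column x A"
proof -
  define B :: "real ^ 'm ^ 'd" where "B = (\<chi> i x. if x \<in> Y then A $ i $ x else 0)"
  define l' where "l' = (\<chi> x. if x \<in> Y then l $ x else 0)"
  let ?R = "range (adjoint ((*v) B))"
  have "l' \<in> ((*v) B -` {0})\<^sup>\<bottom>"
  proof -
    have "v \<bullet> l' = 0" if "B *v v = 0" for v
    proof -
      define n where "n = (\<chi> x. if x \<in> Y then v $ x else 0)"
      have "A *v n = B *v v"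
        by (auto simp: vec_eq_iff matrix_vector_mult_def n_def B_def intro!: sum.cong)
      moreover have "vec_supp n \<subseteq> Y"
        by (auto simp: n_def vec_supp_def split: if_splits)
      ultimately have "n \<bullet> l = 0"
        using assms[of n] that by simp
      moreover have "n \<bullet> l = v \<bullet> l'"
        by (auto simp: inner_vec_def n_def l'_def intro!: sum.cong)
      ultimately show ?thesis
        by simp
    qed
    then show ?thesis
      by (auto simp: orthogonal_comp_def orthogonal_def)
  qed
  also have "(*v) B -` {0} = ?R\<^sup>\<bottom>"
    by (rule ker_orthogonal_comp_adjoint) simp
  also have "?R\<^sup>\<bottom>\<^sup>\<bottom> = ?R"
    by (intro orthogonal_comp_self linear_subspace_image adjoint_linear) simp_all
  finally obtain \<theta> where "l' = \<theta> v* B"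
    by (auto simp: adjoint_matrix)
  have "l $ x = \<theta> \<bullet> column x A" if "x \<in> Y" for x
  proof -
    have "l $ x = (\<theta> v* B) $ x"
      using that by (simp add: l'_def flip: \<open>l' = \<theta> v* B\<close>)
    also have "\<dots> = (\<theta> v* A) $ x"
      using that by (simp add: B_def vector_matrix_mult_def)
    finally show ?thesis
      by (simp add: inner_column)
  qed
  then show thesis
    using that by blast
qed

text \<open>A theorem of the alternative in the style of Stiemke.  The kernel enlarged by all vectors
  supported in \<open>Y\<close> is a subspace that misses the simplex spanned by the unit vectors outside
  \<open>Y\<close>.  A functional that strictly separates the two is bounded, hence zero, on the subspace,
  so it lies in the row space and vanishes on \<open>Y\<close>; it has one strict sign on the simplex.\<close>

lemma exposing_functional:
  fixes A :: "real ^ 'm::finite ^ 'd::finite"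
  assumes "\<And>n. A *v n = 0 \<Longrightarrow> \<forall>x. x \<notin> Y \<longrightarrow> 0 \<le> n $ x \<Longrightarrow> \<forall>x. x \<notin> Y \<longrightarrow> n $ x = 0"
  obtains \<eta> where "\<And>x. x \<in> Y \<Longrightarrow> \<eta> \<bullet> column x A = 0" "\<And>x. x \<notin> Y \<Longrightarrow> \<eta> \<bullet> column x A < 0"
proof (cases "Y = UNIV")
  case True
  then show thesis
    using that[of 0] by simp
next
  case False
  define M where "M = {m. \<exists>n. A *v n = 0 \<and> (\<forall>x. x \<notin> Y \<longrightarrow> m $ x = n $ x)}"
  define S :: "(real ^ 'm) set" where "S = convex hull ((\<lambda>x. axis x 1) ` (- Y))"
  define S' :: "(real ^ 'm) set" where "S' = {u. (\<forall>x. 0 \<le> u $ x) \<and> (\<forall>x\<in>Y. u $ x = 0) \<and> (\<Sum>x\<in>UNIV. u $ x) = 1}"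
  have "subspace M"
  proof (rule subspaceI)
    show "0 \<in> M"
      unfolding M_def by (auto intro!: exI[of _ 0])
  next
    fix a b assume "a \<in> M" "b \<in> M"
    then obtain n n' where "A *v n = 0" "\<forall>x. x \<notin> Y \<longrightarrow> a $ x = n $ x"
      "A *v n' = 0" "\<forall>x. x \<notin> Y \<longrightarrow> b $ x = n' $ x"
      unfolding M_def by auto
    then show "a + b \<in> M"
      unfolding M_def by (auto simp: matrix_vector_right_distrib intro!: exI[of _ "n + n'"])
  next
    fix a r assume "a \<in> M"
    then obtain n where "A *v n = 0" "\<forall>x. x \<notin> Y \<longrightarrow> a $ x = n $ x"
      unfolding M_def by auto
    then show "r *\<^sub>R a \<in> M"
      unfolding M_def by (auto simp: matrix_vector_mult_scaleR intro!: exI[of _ "r *\<^sub>R n"])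
  qed
  have "S \<subseteq> S'"
    unfolding S_def
  proof (rule hull_minimal)
    show "(\<lambda>x. axis x 1) ` (- Y) \<subseteq> S'"
      by (auto simp: S'_def axis_def)
    show "convex S'"
    proof (rule convexI)
      fix u v :: "real ^ 'm" and a b :: real
      assume uv: "u \<in> S'" "v \<in> S'" and ab: "0 \<le> a" "0 \<le> b" "a + b = 1"
      have "(\<Sum>x\<in>UNIV. (a *\<^sub>R u + b *\<^sub>R v) $ x) =
          a * (\<Sum>x\<in>UNIV. u $ x) + b * (\<Sum>x\<in>UNIV. v $ x)"
        by (simp add: sum.distrib sum_distrib_left)
      then show "a *\<^sub>R u + b *\<^sub>R v \<in> S'"
        using uv ab by (simp add: S'_def)
    qed
  qed
  have "M \<inter> S = {}"
  proof (rule ccontr)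
    assume "M \<inter> S \<noteq> {}"
    then obtain u where "u \<in> M" "u \<in> S'"
      using \<open>S \<subseteq> S'\<close> by blast
    then obtain n where n: "A *v n = 0" "\<forall>x. x \<notin> Y \<longrightarrow> u $ x = n $ x"
      by (auto simp: M_def)
    have u: "\<And>x. 0 \<le> u $ x" "\<And>x. x \<in> Y \<Longrightarrow> u $ x = 0" "(\<Sum>x\<in>UNIV. u $ x) = 1"
      using \<open>u \<in> S'\<close> by (auto simp: S'_def)
    have "\<forall>x. x \<notin> Y \<longrightarrow> n $ x = 0"
      using assms[of n] n u(1) by metis
    then have "u $ x = 0" for x
      using u(2) n by metis
    then have "(\<Sum>x\<in>UNIV. u $ x) = 0"
      by (intro sum.neutral) auto
    then show False
      using u(3) by simp
  qed
  moreover have "convex M" "closed M"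
    using \<open>subspace M\<close> by (auto intro: subspace_imp_convex closed_subspace)
  moreover have "convex S" "compact S" "S \<noteq> {}"
    using False by (auto simp: S_def intro!: finite_imp_compact_convex_hull)
  ultimately obtain f b where f: "\<And>m. m \<in> M \<Longrightarrow> f \<bullet> m < b" "\<And>u. u \<in> S \<Longrightarrow> b < f \<bullet> u"
    using separating_hyperplane_closed_compact[of M S] by blast
  have "0 < b"
    using f(1)[OF subspace_0[OF \<open>subspace M\<close>]] by simp
  have f_zero: "f \<bullet> m = 0" if "m \<in> M" for m
  proof (rule ccontr)
    assume "f \<bullet> m \<noteq> 0"
    moreover have "f \<bullet> ((b / (f \<bullet> m)) *\<^sub>R m) < b"
      using that \<open>subspace M\<close> by (intro f(1) subspace_scale)
    ultimately show False
      by simp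
  qed
  have "n \<bullet> f = 0" if "A *v n = 0" for n
    using f_zero[of n] that by (auto simp: M_def inner_commute)
  then obtain \<theta> where \<theta>: "\<And>x. f $ x = \<theta> \<bullet> column x A"
    using row_space_on_if_orthogonal_kernel[of A UNIV f] by auto
  show thesis
  proof (rule that[of "- \<theta>"])
    fix x assume "x \<in> Y"
    then have "axis x 1 \<in> M"
      by (auto simp: M_def axis_def intro!: exI[of _ 0])
    then show "- \<theta> \<bullet> column x A = 0"
      using f_zero[of "axis x 1"] \<theta> by (simp add: inner_axis)
  next
    fix x assume "x \<notin> Y"
    then have "axis x 1 \<in> S"
      unfolding S_def by (auto intro!: hull_inc)
    then show "- \<theta> \<bullet> column x A < 0"
      using f(2)[of "axis x 1"] \<open>0 < b\<close> \<theta>[of x] by (simp add: inner_axis)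
  qed
qed

section \<open>The binomial equations\<close>

lemma vec_power_eq_exp:
  assumes "\<And>x. u $ x \<noteq> 0 \<Longrightarrow> 0 < p $ x"
  shows "vec_power p u = exp (\<Sum>x\<in>UNIV. u $ x * ln (p $ x))"
  unfolding vec_power_def exp_sum[OF finite]
  using assms by (intro prod.cong) (force simp: powr_def)+

lemma vec_power_eq_0_iff: "vec_power p u = 0 \<longleftrightarrow> (\<exists>x. u $ x \<noteq> 0 \<and> p $ x = 0)"
  by (auto simp: vec_power_def)

lemma pos_part_nonzero_iff: "pos_part c $ x \<noteq> 0 \<longleftrightarrow> 0 < c $ x"
  by (auto simp: pos_part_def)

lemma neg_part_nonzero_iff: "neg_part c $ x \<noteq> 0 \<longleftrightarrow> c $ x < 0"
  by (auto simp: neg_part_def)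

lemma binomial_equation_iff:
  assumes q: "\<And>x. 0 < q $ x" and p: "\<And>x. c $ x \<noteq> 0 \<Longrightarrow> 0 < p $ x"
  shows "vec_power p (pos_part c) * vec_power q (neg_part c) =
      vec_power p (neg_part c) * vec_power q (pos_part c) \<longleftrightarrow>
    (\<Sum>x\<in>UNIV. c $ x * ln (p $ x / q $ x)) = 0"
proof -
  have "pos_part c $ x \<noteq> 0 \<Longrightarrow> 0 < p $ x" "neg_part c $ x \<noteq> 0 \<Longrightarrow> 0 < p $ x" for x
    using p[of x] unfolding pos_part_nonzero_iff neg_part_nonzero_iff by auto
  then have "vec_power p (pos_part c) = exp (\<Sum>x\<in>UNIV. pos_part c $ x * ln (p $ x))"
    "vec_power p (neg_part c) = exp (\<Sum>x\<in>UNIV. neg_part c $ x * ln (p $ x))"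
    by (blast intro: vec_power_eq_exp)+
  moreover have "vec_power q (pos_part c) = exp (\<Sum>x\<in>UNIV. pos_part c $ x * ln (q $ x))"
    "vec_power q (neg_part c) = exp (\<Sum>x\<in>UNIV. neg_part c $ x * ln (q $ x))"
    using q by (auto intro!: vec_power_eq_exp)
  moreover have "(\<Sum>x\<in>UNIV. c $ x * ln (p $ x / q $ x)) =
      (\<Sum>x\<in>UNIV. pos_part c $ x * ln (p $ x)) + (\<Sum>x\<in>UNIV. neg_part c $ x * ln (q $ x)) -
      ((\<Sum>x\<in>UNIV. neg_part c $ x * ln (p $ x)) + (\<Sum>x\<in>UNIV. pos_part c $ x * ln (q $ x)))"
    unfolding sum.distrib[symmetric] sum_subtractf[symmetric]
  proof (rule sum.cong[OF refl])
    fix x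
    show "c $ x * ln (p $ x / q $ x) =
      pos_part c $ x * ln (p $ x) + neg_part c $ x * ln (q $ x) -
      (neg_part c $ x * ln (p $ x) + pos_part c $ x * ln (q $ x))"
    proof (cases "c $ x = 0")
      case False
      then show ?thesis
        using p[OF False] q[of x]
        by (auto simp: pos_part_def neg_part_def max_def ln_div algebra_simps)
    qed (simp add: pos_part_def neg_part_def)
  qed
  ultimately show ?thesis
    by (simp add: exp_add[symmetric])
qed

lemma continuous_on_vec_power:
  assumes "\<And>x. 0 \<le> u $ x"
  shows "continuous_on prob_distributions (\<lambda>p. vec_power p u)"
  unfolding vec_power_def
proof (rule continuous_on_prod)
  fix x
  show "continuous_on prob_distributions (\<lambda>p. if u $ x = 0 then 1 else p $ x powr u $ x)"
  proof (cases "u $ x = 0")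
    case False
    then have "0 < u $ x"
      using assms[of x] by simp
    then show ?thesis
      by (simp, intro continuous_on_powr' continuous_intros) (simp add: prob_distributions_def)
  qed simp
qed

lemma closed_prob_distributions: "closed (prob_distributions :: (real ^ 'm::finite) set)"
  unfolding prob_distributions_def
  by (intro closed_Collect_conj closed_Collect_all closed_Collect_le closed_Collect_eq)
    (auto intro!: continuous_intros)

section \<open>The exponential family and its closure\<close>

lemma partition_fun_pos:
  assumes "\<And>x. 0 < q $ x"
  shows "0 < partition_fun q A \<theta>"
  unfolding partition_fun_def using assms by (intro sum_pos) auto

lemma exp_family_binomial_equation:
  fixes A :: "real ^ 'm::finite ^ 'd::finite"
  assumes q: "\<And>x. 0 < q $ x" and ones: "(\<chi> x. 1) \<in> span (rows A)"
    and c: "A *v c = 0" and p: "p \<in> exp_family q A"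
  shows "vec_power p (pos_part c) * vec_power q (neg_part c) =
    vec_power p (neg_part c) * vec_power q (pos_part c)"
proof -
  obtain \<theta> where \<theta>: "\<And>x. p $ x = q $ x / partition_fun q A \<theta> * exp (\<theta> \<bullet> column x A)"
    and pos: "\<And>x. 0 < p $ x"
    using p by (auto simp: exp_family_def open_simplex_def)
  let ?Z = "partition_fun q A \<theta>"
  have "ln (p $ x / q $ x) = \<theta> \<bullet> column x A - ln ?Z" for x
  proof -
    have "p $ x / q $ x = exp (\<theta> \<bullet> column x A) / ?Z"
      using q[of x] by (simp add: \<theta>)
    then show ?thesis
      using partition_fun_pos[OF q, of A \<theta>] by (simp add: ln_div)
  qed
  then have "(\<Sum>x\<in>UNIV. c $ x * ln (p $ x / q $ x)) =
      (\<Sum>x\<in>UNIV. c $ x * (\<theta> \<bullet> column x A)) - (\<Sum>x\<in>UNIV. c $ x) * ln ?Z"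
    by (simp add: right_diff_distrib sum_subtractf sum_distrib_right)
  also have "\<dots> = 0"
    by (simp add: sum_kernel_inner_column[OF c] sum_kernel_zero[OF ones c])
  finally show ?thesis
    by (simp add: binomial_equation_iff[OF q pos])
qed

lemma normalized_mem_exp_family:
  fixes A :: "real ^ 'm::finite ^ 'd::finite"
  assumes "\<And>x. 0 < q $ x"
  shows "(\<chi> x. q $ x / partition_fun q A \<theta> * exp (\<theta> \<bullet> column x A)) \<in> exp_family q A"
proof -
  have "(\<Sum>x\<in>UNIV. q $ x / partition_fun q A \<theta> * exp (\<theta> \<bullet> column x A)) =
      partition_fun q A \<theta> / partition_fun q A \<theta>"
    unfolding partition_fun_def[where \<theta> = \<theta>] sum_divide_distrib by simp
  then show ?thesis
    using assms partition_fun_pos[of q A \<theta>]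
    by (auto simp: exp_family_def open_simplex_def)
qed

text \<open>Along the ray \<open>\<theta> + k \<eta>\<close> the unnormalized weights are constant on the support of
  \<open>p\<close> and decay exponentially off it; as \<open>p\<close> has total mass 1, the normalizing constants
  tend to 1.\<close>

lemma mem_closure_exp_family:
  fixes A :: "real ^ 'm::finite ^ 'd::finite"
  assumes q: "\<And>x. 0 < q $ x" and sum1: "(\<Sum>x\<in>UNIV. p $ x) = 1"
    and \<theta>: "\<And>x. p $ x \<noteq> 0 \<Longrightarrow> p $ x = q $ x * exp (\<theta> \<bullet> column x A)"
    and \<eta>0: "\<And>x. p $ x \<noteq> 0 \<Longrightarrow> \<eta> \<bullet> column x A = 0"
    and \<eta>neg: "\<And>x. p $ x = 0 \<Longrightarrow> \<eta> \<bullet> column x A < 0"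
  shows "p \<in> closure (exp_family q A)"
proof -
  define \<phi> where "\<phi> k = \<theta> + real k *\<^sub>R \<eta>" for k
  have w: "(\<lambda>k. q $ x * exp (\<phi> k \<bullet> column x A)) \<longlonglongrightarrow> p $ x" for x
  proof (cases "p $ x = 0")
    case True
    have "\<bar>exp (\<eta> \<bullet> column x A)\<bar> < 1"
      using \<eta>neg[OF True] by simp
    then have "(\<lambda>k. exp (\<eta> \<bullet> column x A) ^ k) \<longlonglongrightarrow> 0"
      by (simp add: LIMSEQ_power_zero)
    then have "(\<lambda>k. q $ x * exp (\<theta> \<bullet> column x A) * exp (\<eta> \<bullet> column x A) ^ k) \<longlonglongrightarrow> 0"
      by (rule tendsto_mult_right_zero)
    moreover have "\<And>k. q $ x * exp (\<phi> k \<bullet> column x A) =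
        q $ x * exp (\<theta> \<bullet> column x A) * exp (\<eta> \<bullet> column x A) ^ k"
      by (simp add: \<phi>_def inner_add_left exp_add exp_of_nat_mult)
    ultimately show ?thesis
      unfolding True by (simp only:)
  next
    case False
    then show ?thesis
      using \<theta>[OF False] \<eta>0[OF False] by (simp add: \<phi>_def inner_add_left)
  qed
  have Z: "(\<lambda>k. partition_fun q A (\<phi> k)) \<longlonglongrightarrow> 1"
    unfolding partition_fun_def sum1[symmetric] by (intro tendsto_sum w)
  have "(\<lambda>k. \<chi> x. q $ x / partition_fun q A (\<phi> k) * exp (\<phi> k \<bullet> column x A)) \<longlonglongrightarrow> p"
  proof (rule vec_tendstoI)
    fix x
    have "(\<lambda>k. q $ x * exp (\<phi> k \<bullet> column x A) / partition_fun q A (\<phi> k)) \<longlonglongrightarrow> p $ x / 1"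
      by (intro tendsto_divide w Z) simp
    then show "(\<lambda>k. (\<chi> x. q $ x / partition_fun q A (\<phi> k) * exp (\<phi> k \<bullet> column x A)) $ x) \<longlonglongrightarrow> p $ x"
      by simp
  qed
  moreover have "(\<chi> x. q $ x / partition_fun q A (\<phi> k) * exp (\<phi> k \<bullet> column x A)) \<in> exp_family q A" for k
    using q by (rule normalized_mem_exp_family)
  ultimately show ?thesis
    unfolding closure_sequential by (intro exI conjI allI)
qed

theorem theorem10:
  fixes q :: "real ^ 'm::finite"
    and A :: "real ^ 'm ^ 'd::finite"
    and C :: "(real ^ 'm) set"
  assumes "\<And>x. 0 < q $ x"
    and "(\<chi> x. 1) \<in> span (rows A)"
    and "circuit_basis A C"
  shows "closure (exp_family q A) =
    {p \<in> prob_distributions. \<forall>c\<in>C.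
       vec_power p (pos_part c) * vec_power q (neg_part c) =
       vec_power p (neg_part c) * vec_power q (pos_part c)}"
    (is "_ = ?V")
proof (rule equalityI)
  let ?E = "\<lambda>c p. vec_power p (pos_part c) * vec_power q (neg_part c) =
       vec_power p (neg_part c) * vec_power q (pos_part c)"
  have C_circuit: "circuit_vector A c" if "c \<in> C" for c
    using assms(3) that by (simp add: circuit_basis_def)
  show "closure (exp_family q A) \<subseteq> ?V"
  proof (rule closure_minimal)
    show "exp_family q A \<subseteq> ?V"
    proof
      fix p assume p: "p \<in> exp_family q A"
      then have "p \<in> prob_distributions"
        by (auto simp: exp_family_def open_simplex_def prob_distributions_def less_imp_le)
      moreover have "?E c p" if "c \<in> C" for c
        using exp_family_binomial_equation[OF assms(1,2) _ p] C_circuit[OF that]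
        by (simp add: circuit_vector_def)
      ultimately show "p \<in> ?V"
        by blast
    qed
    have "closed {p \<in> prob_distributions. ?E c p}" for c
    proof -
      have "closed {p \<in> prob_distributions. vec_power p (pos_part c) * vec_power q (neg_part c) -
          vec_power p (neg_part c) * vec_power q (pos_part c) = 0}"
        by (intro continuous_closed_preimage_constant closed_prob_distributions continuous_intros
            continuous_on_vec_power) (simp_all add: pos_part_def neg_part_def)
      then show ?thesis
        by simp
    qed
    moreover have "?V = prob_distributions \<inter> (\<Inter>c\<in>C. {p \<in> prob_distributions. ?E c p})"
      by blast
    ultimately show "closed ?V"
      using closed_prob_distributions by (auto intro!: closed_Int closed_INT)
  qed
  show "?V \<subseteq> closure (exp_family q A)"
  proof
    fix p assume "p \<in> ?V"
    then have nonneg: "\<And>x. 0 \<le> p $ x" and sum1: "(\<Sum>x\<in>UNIV. p $ x) = 1"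
      and eq: "\<And>c. c \<in> C \<Longrightarrow> ?E c p"
      by (auto simp: prob_distributions_def)
    define Y where "Y = vec_supp p"
    have Y: "x \<in> Y \<longleftrightarrow> p $ x \<noteq> 0" for x
      by (simp add: Y_def vec_supp_def)
    define l :: "real ^ 'm" where "l = (\<chi> x. ln (p $ x / q $ x))"
    have "n \<bullet> l = 0" if n: "circuit_vector A n" "vec_supp n \<subseteq> Y" for n
    proof -
      obtain c r where c: "c \<in> C" "r \<noteq> 0" "n = r *\<^sub>R c"
        using circuit_vector_multiple_of_basis[OF assms(3) n(1)] .
      have "0 < p $ x" if "c $ x \<noteq> 0" for x
        using that n(2) c nonneg[of x] by (auto simp: Y_def vec_supp_def order_less_le)
      then have "(\<Sum>x\<in>UNIV. c $ x * ln (p $ x / q $ x)) = 0"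
        using eq[OF c(1)] binomial_equation_iff[OF assms(1)] by blast
      then have "c \<bullet> l = 0"
        by (simp add: inner_vec_def l_def)
      then show ?thesis
        using c(3) by simp
    qed
    then have "n \<bullet> l = 0" if "A *v n = 0" "vec_supp n \<subseteq> Y" for n
      using kernel_orthogonal_if_circuits_orthogonal that by blast
    then obtain \<theta> where \<theta>: "\<And>x. x \<in> Y \<Longrightarrow> l $ x = \<theta> \<bullet> column x A"
      using row_space_on_if_orthogonal_kernel by blast
    have "\<forall>x. x \<notin> Y \<longrightarrow> n $ x = 0"
      if n: "circuit_vector A n" "\<forall>x. x \<notin> Y \<longrightarrow> 0 \<le> n $ x" for n
    proof -
      obtain c r where c: "c \<in> C" "r \<noteq> 0" "n = r *\<^sub>R c"
        using circuit_vector_multiple_of_basis[OF assms(3) n(1)] .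
      have nz: "vec_power q u \<noteq> 0" for u
        using assms(1) by (metis less_irrefl vec_power_eq_0_iff)
      have "vec_power p (pos_part c) = 0 \<longleftrightarrow> vec_power p (neg_part c) = 0"
        using eq[OF c(1)] nz by (metis mult_eq_0_iff)
      \<comment> \<open>The left side of the equation vanishes iff \<open>c\<close> is positive somewhere off \<open>Y\<close>, the right
        side iff it is negative somewhere off \<open>Y\<close>; this is symmetric in the sign of \<open>r\<close>.\<close>
      then have balance: "(\<exists>x. x \<notin> Y \<and> 0 < c $ x) \<longleftrightarrow> (\<exists>x. x \<notin> Y \<and> c $ x < 0)"
        by (simp add: vec_power_eq_0_iff pos_part_nonzero_iff neg_part_nonzero_iff Y conj_commute)
      have sgn: "0 \<le> r * c $ x" if "x \<notin> Y" for x
        using n(2) that c(3) by simp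
      have "c $ x = 0" if "x \<notin> Y" for x
        using balance sgn that c(2) by (metis linorder_neqE mult_pos_neg mult_neg_pos not_less)
      then show ?thesis
        using c(3) by simp
    qed
    then have "\<forall>x. x \<notin> Y \<longrightarrow> n $ x = 0" if "A *v n = 0" "\<forall>x. x \<notin> Y \<longrightarrow> 0 \<le> n $ x" for n
      using kernel_face_condition_if_circuits[of A Y n] that by blast
    then obtain \<eta> where \<eta>: "\<And>x. x \<in> Y \<Longrightarrow> \<eta> \<bullet> column x A = 0"
      "\<And>x. x \<notin> Y \<Longrightarrow> \<eta> \<bullet> column x A < 0"
      using exposing_functional[of A Y] by blast
    show "p \<in> closure (exp_family q A)"
    proof (rule mem_closure_exp_family[OF assms(1) sum1])
      fix x assume "p $ x \<noteq> 0"
      then have "0 < p $ x / q $ x" "\<theta> \<bullet> column x A = ln (p $ x / q $ x)"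
        using nonneg[of x] assms(1)[of x] \<theta>[of x] by (auto simp: Y l_def order_less_le)
      then show "p $ x = q $ x * exp (\<theta> \<bullet> column x A)"
        using assms(1)[of x] by simp
    qed (use \<eta> Y in auto)
  qed
qed

end
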